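(* We have the group inclusion $L_n\unlhd M_n$ and $[M_n:L_n]=2$.
   Context: Let $\mathcal{T}$ be the rooted $3$-ary tree whose vertices are words over $X=\{0,1,2\}$, and $\mathcal{T}_n$ its truncation at level $n$. Via sections, $\mathrm{Aut}(\mathcal{T}_n)\cong(\mathrm{Aut}(\mathcal{T}_{n-1})\times\mathrm{Aut}(\mathcal{T}_{n-1})\times\mathrm{Aut}(\mathcal{T}_{n-1}))\rtimes S_3$, and an element is written $(\sigma_0,\sigma_1,\sigma_2)\pi$ with $\sigma_i\in\mathrm{Aut}(\mathcal{T}_{n-1})$ (the section at vertex $i$) and $\pi\in S_3$ (action on the first level). $\mathrm{Aut}(\mathcal{T}_{n-1})$ is embedded in $\mathrm{Aut}(\mathcal{T}_n)$ by $\sigma\mapsto(\sigma,\mathrm{id},\mathrm{id})$. Define elements recursively by $x_1=(0,1,2)$, $y_1=(0,1)$, $z_1=\mathrm{id}$ in $S_3=\mathrm{Aut}(\mathcal{T}_1)$, and for $n\ge 2$: $x_n=(\mathrm{id},\mathrm{id},x_{n-1})(0,1,2)$, $y_n=(\mathrm{id},y_{n-1},x_{n-1})(0,1)$, $z_n=(y_{n-1},y_{n-1},x_{n-1})$ (these are the iterates, under the Markov model for a PCF cubic with combined critical orbit of length one, of the elements $(0,1,2)$, $(0,1)$, $\mathrm{id}$ carrying types $[s,3]$, $[n,2][s,1]$, $[n,1]^2[s,1]$ respectively). Let $L_0$ be trivial, $L_n=\langle x_n,z_n,L_{n-1}\rangle$ and $M_n=\langle x_n,y_n,z_n,L_{n-1}\rangle$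 (so $M_1=S_3$). *)

theory Defs
  imports "HOL-Algebra.Bij" "HOL-Algebra.Generated_Groups" "HOL-Combinatorics.Cycles"
begin

definition tree_verts :: "nat \<Rightarrow> nat list set" where
  "tree_verts n = {w. set w \<subseteq> {0, 1, 2} \<and> length w \<le> n}"

definition tree_adj :: "nat list \<Rightarrow> nat list \<Rightarrow> bool" where
  "tree_adj u v \<longleftrightarrow> (\<exists>i. v = u @ [i]) \<or> (\<exists>i. u = v @ [i])"

definition tree_aut :: "nat \<Rightarrow> (nat list \<Rightarrow> nat list) monoid" where
  "tree_aut n = (BijGroup (tree_verts n))
     \<lparr>carrier := {f \<in> Bij (tree_verts n). f [] = [] \<and>
        (\<forall>u \<in> tree_verts n. \<forall>v \<in> tree_verts n. tree_adj (f u) (f v) \<longleftrightarrow> tree_adj u v)}\<rparr>"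

abbreviation tree_id :: "nat \<Rightarrow> nat list \<Rightarrow> nat list" where
  "tree_id n \<equiv> \<one>\<^bsub>tree_aut n\<^esub>"

text \<open>
  The element \<open>(s\<^sub>0, s\<^sub>1, s\<^sub>2) \<pi>\<close> of the automorphism group of the tree truncated at level \<open>n\<close>,
  where \<open>s\<^sub>i\<close> is the section at the vertex \<open>i\<close>, that is, \<open>i v \<mapsto> \<pi>(i) s\<^sub>i(v)\<close>.
  Whether automorphisms are composed from the left or from the right does not affect the
  subgroups generated by a set of them.
\<close>
definition from_sections ::
    "nat \<Rightarrow> (nat list \<Rightarrow> nat list) \<Rightarrow> (nat list \<Rightarrow> nat list) \<Rightarrow> (nat list \<Rightarrow> nat list)
      \<Rightarrow> (nat \<Rightarrow> nat) \<Rightarrow> (nat list \<Rightarrow> nat list)" where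
  "from_sections n s\<^sub>0 s\<^sub>1 s\<^sub>2 \<pi> =
     (\<lambda>w \<in> tree_verts n. case w of [] \<Rightarrow> [] | i # v \<Rightarrow> \<pi> i # ([s\<^sub>0, s\<^sub>1, s\<^sub>2] ! i) v)"

definition level_one :: "(nat \<Rightarrow> nat) \<Rightarrow> (nat list \<Rightarrow> nat list)" where
  "level_one \<pi> = from_sections 1 (tree_id 0) (tree_id 0) (tree_id 0) \<pi>"

definition tree_embed :: "nat \<Rightarrow> (nat list \<Rightarrow> nat list) \<Rightarrow> (nat list \<Rightarrow> nat list)" where
  "tree_embed n \<sigma> = from_sections n \<sigma> (tree_id (n - 1)) (tree_id (n - 1)) id"

text \<open>The values at index \<open>0\<close> in the following three definitions are dummies.\<close>

fun x_elt :: "nat \<Rightarrow> nat list \<Rightarrow> nat list" where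
  "x_elt 0 = tree_id 0"
| "x_elt (Suc 0) = level_one (cycle_of_list [0, 1, 2])"
| "x_elt (Suc (Suc n)) =
     from_sections (Suc (Suc n)) (tree_id (Suc n)) (tree_id (Suc n)) (x_elt (Suc n))
       (cycle_of_list [0, 1, 2])"

fun y_elt :: "nat \<Rightarrow> nat list \<Rightarrow> nat list" where
  "y_elt 0 = tree_id 0"
| "y_elt (Suc 0) = level_one (cycle_of_list [0, 1])"
| "y_elt (Suc (Suc n)) =
     from_sections (Suc (Suc n)) (tree_id (Suc n)) (y_elt (Suc n)) (x_elt (Suc n))
       (cycle_of_list [0, 1])"

fun z_elt :: "nat \<Rightarrow> nat list \<Rightarrow> nat list" where
  "z_elt 0 = tree_id 0"
| "z_elt (Suc 0) = tree_id 1"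
| "z_elt (Suc (Suc n)) =
     from_sections (Suc (Suc n)) (y_elt (Suc n)) (y_elt (Suc n)) (x_elt (Suc n)) id"

fun L_grp :: "nat \<Rightarrow> (nat list \<Rightarrow> nat list) set" where
  "L_grp 0 = {tree_id 0}"
| "L_grp (Suc n) = generate (tree_aut (Suc n))
     ({x_elt (Suc n), z_elt (Suc n)} \<union> tree_embed (Suc n) ` L_grp n)"

text \<open>Meaningful for \<open>n \<ge> 1\<close> only.\<close>
definition M_grp :: "nat \<Rightarrow> (nat list \<Rightarrow> nat list) set" where
  "M_grp n = generate (tree_aut n)
     ({x_elt n, y_elt n, z_elt n} \<union> tree_embed n ` L_grp (n - 1))"

end

theory Submission
  imports Defs
begin

text \<open>
  The sequences satisfy their recursion already from the trivial level \<open>0\<close> on, and the induction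
  only has to carry \<open>x\<^sub>n \<in> L\<^sub>n\<close> and \<open>y\<^sub>n\<^sup>2 \<in> L\<^sub>n\<close>.  Conjugating the embedded copy of
  \<open>L\<^sub>n\<close> by \<open>x\<^sub>n\<^sub>+\<^sub>1\<close> puts \<open>L\<^sub>n \<times> L\<^sub>n \<times> L\<^sub>n\<close> inside \<open>L\<^sub>n\<^sub>+\<^sub>1\<close>, and together with
  \<open>z\<^sub>n\<^sub>+\<^sub>1\<close> also \<open>(y\<^sub>n, y\<^sub>n, id)\<close>.  With
  \<open>x = x\<^sub>n\<close>, \<open>y = y\<^sub>n\<close>, and \<open>X\<close>, \<open>Y\<close>, \<open>Z\<close> their
  successors, \<open>Y Y = (y, y, x\<^sup>2)\<close>, \<open>Y Z = Z Y\<close>, \<open>Y (a, id, id) = (id, a, id) Y\<close> and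
  \<open>X Y X = (x\<^sup>2 y\<^sup>-\<^sup>1, y, id) Y\<close>, so \<open>Y\<close> normalises \<open>L\<^sub>n\<^sub>+\<^sub>1\<close> and its square
  lies there.  Finally \<open>Y\<close> is not in \<open>L\<^sub>n\<^sub>+\<^sub>1\<close>, because it acts on the first level by an odd
  permutation and \<open>L\<^sub>n\<^sub>+\<^sub>1\<close> by rotations only.
\<close>

section \<open>Subgroups of index two, recognised on generators\<close>

text \<open>Write \<open>H\<close> for the group generated by \<open>S\<close>. As conjugation by
  \<open>y\<close> maps \<open>H\<close> into itself and \<open>y \<otimes> y\<close> is in
  \<open>H\<close>, the union of \<open>H\<close> and \<open>H #> y\<close> is closed under products
  and inverses, hence is all of the larger group. Normality and the count of cosets are read off
  from this decomposition.\<close>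

lemma (in group) generate_insert_index_two:
  assumes S: "S \<subseteq> carrier G" and y: "y \<in> carrier G"
    and conj: "\<And>s. s \<in> S \<Longrightarrow> y \<otimes> s \<otimes> inv y \<in> generate G S"
    and sq: "y \<otimes> y \<in> generate G S"
    and notin: "y \<notin> generate G S"
  shows "generate G S \<lhd> G\<lparr>carrier := generate G (insert y S)\<rparr>"
    and "card (rcosets\<^bsub>G\<lparr>carrier := generate G (insert y S)\<rparr>\<^esub> (generate G S)) = 2"
proof -
  define H where "H = generate G S"
  define M where "M = generate G (insert y S)"
  have H: "subgroup H G" unfolding H_def by (rule generate_is_subgroup[OF S])
  have M: "subgroup M G" unfolding M_def using S y by (intro generate_is_subgroup) auto
  have HM: "H \<subseteq> M" unfolding H_def M_def by (rule mono_generate) auto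
  have yM: "y \<in> M" unfolding M_def by (rule generate.incl) simp
  note Hc = subgroup.mem_carrier[OF H]
  have cancel: "inv y \<otimes> (y \<otimes> a) = a" if "a \<in> carrier G" for a
    using that y by (simp add: m_assoc[symmetric])
  have conjH: "y \<otimes> h \<otimes> inv y \<in> H" if "h \<in> H" for h
    using that unfolding H_def
  proof (induction rule: generate.induct)
    case one then show ?case using y by (simp add: generate.one)
  next
    case (incl h) then show ?case by (rule conj)
  next
    case (inv h)
    then have h: "h \<in> carrier G" using S by auto
    have "inv (y \<otimes> h \<otimes> inv y) \<in> generate G S"
      using conj[OF inv] subgroup.m_inv_closed[OF H] by (simp add: H_def)
    then show ?case using h y by (simp add: inv_mult_group m_assoc)
  next
    case (eng a b)
    then have "a \<in> carrier G" "b \<in> carrier G" using Hc by (auto simp: H_def)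
    then have "(y \<otimes> a \<otimes> inv y) \<otimes> (y \<otimes> b \<otimes> inv y) = y \<otimes> (a \<otimes> b) \<otimes> inv y"
      using y by (simp add: m_assoc cancel)
    then show ?case using subgroup.m_closed[OF H] eng by (metis H_def)
  qed
  have sqH: "y \<otimes> y \<in> H" using sq by (simp add: H_def)
  \<comment> \<open>The decomposition of \<open>M\<close> into \<open>H\<close> and
    \<open>H #> y\<close>, by induction on the generation of \<open>g\<close>.\<close>
  have mem: "g \<in> H \<or> g \<in> H #> y" if "g \<in> M" for g
    using that unfolding M_def
  proof (induction rule: generate.induct)
    case one then show ?case using subgroup.one_closed[OF H] by simp
  next
    case (incl h)
    then show ?case
      using subgroup.one_closed[OF H] y by (force simp: r_coset_def H_def intro: generate.incl)
  next
    case (inv h)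
    show ?case
    proof (cases "h = y")
      case True
      \<comment> \<open>The inverse of \<open>y\<close> returns to the coset \<open>H #> y\<close>
        because \<open>y \<otimes> y\<close> is in \<open>H\<close>.\<close>
      have "inv y = inv (y \<otimes> y) \<otimes> y" using y by (simp add: inv_mult_group m_assoc)
      then show ?thesis
        using True subgroup.m_inv_closed[OF H sqH] by (auto simp: r_coset_def)
    next
      case False
      then show ?thesis using inv by (auto simp: H_def intro: generate.inv)
    qed
  next
    case (eng a b)
    from eng.IH show ?case
    proof (elim disjE)
      assume "a \<in> H" "b \<in> H"
      then show ?thesis using subgroup.m_closed[OF H] by auto
    next
      assume a: "a \<in> H" and "b \<in> H #> y"
      then obtain h where h: "h \<in> H" "b = h \<otimes> y" by (auto simp: r_coset_def)
      have "a \<otimes> b = (a \<otimes> h) \<otimes> y" using h a Hc y by (simp add: m_assoc)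
      then show ?thesis using subgroup.m_closed[OF H a h(1)] by (auto simp: r_coset_def)
    next
      assume "a \<in> H #> y" and b: "b \<in> H"
      then obtain h where h: "h \<in> H" "a = h \<otimes> y" by (auto simp: r_coset_def)
      \<comment> \<open>Here and in the next case \<open>y\<close> is moved to the right past an
        element of \<open>H\<close>, at the price of conjugating that element.\<close>
      have "a \<otimes> b = (h \<otimes> (y \<otimes> b \<otimes> inv y)) \<otimes> y" using h b Hc y by (simp add: m_assoc)
      then show ?thesis
        using subgroup.m_closed[OF H h(1) conjH[OF b]] by (auto simp: r_coset_def)
    next
      assume "a \<in> H #> y" and "b \<in> H #> y"
      then obtain h k where h: "h \<in> H" "a = h \<otimes> y" and k: "k \<in> H" "b = k \<otimes> y"
        by (auto simp: r_coset_def)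
      have "a \<otimes> b = h \<otimes> (y \<otimes> k \<otimes> inv y) \<otimes> (y \<otimes> y)"
        using h k Hc y by (simp add: m_assoc cancel)
      then show ?thesis
        using subgroup.m_closed[OF H subgroup.m_closed[OF H h(1) conjH[OF k(1)]] sqH] by auto
    qed
  qed
  let ?M = "G\<lparr>carrier := M\<rparr>"
  have gM: "group ?M" by (rule subgroup_imp_group[OF M])
  have HsM: "subgroup H ?M" by (rule subgroup_incl[OF H M HM])
  have normal: "g \<otimes> h \<otimes> inv g \<in> H" if g: "g \<in> M" and h: "h \<in> H" for g h
    using mem[OF g]
  proof
    assume "g \<in> H"
    then show ?thesis using h H by (simp add: subgroup.m_closed subgroup.m_inv_closed)
  next
    assume "g \<in> H #> y"
    then obtain k where k: "k \<in> H" "g = k \<otimes> y" by (auto simp: r_coset_def)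
    have "g \<otimes> h \<otimes> inv g = k \<otimes> (y \<otimes> h \<otimes> inv y) \<otimes> inv k"
      using k h Hc y by (simp add: m_assoc inv_mult_group)
    then show ?thesis
      using H conjH[OF h] k(1) by (simp add: subgroup.m_closed subgroup.m_inv_closed)
  qed
  have "H \<lhd> ?M"
    using HsM normal
    by (auto simp: group.normal_inv_iff[OF gM] m_inv_consistent[OF M])
  then show "generate G S \<lhd> G\<lparr>carrier := generate G (insert y S)\<rparr>"
    by (simp add: H_def M_def)
  have coset_eq: "H #> g = H" if "g \<in> H" for g
    using coset_join2[OF Hc[OF that] H that] .
  have "rcosets\<^bsub>?M\<^esub> H = {H, H #> y}"
  proof -
    \<comment> \<open>Restricting the carrier leaves the multiplication unchanged, so the cosets in
      \<open>?M\<close> are the cosets \<open>H #> g\<close> with \<open>g\<close> in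
      \<open>M\<close>.\<close>
    have "rcosets\<^bsub>?M\<^esub> H = (\<lambda>g. H #> g) ` M" by (auto simp: RCOSETS_def r_coset_def)
    also have "\<dots> = {H, H #> y}"
    proof
      show "(\<lambda>g. H #> g) ` M \<subseteq> {H, H #> y}"
      proof (rule image_subsetI)
        fix g assume "g \<in> M"
        from mem[OF this] show "H #> g \<in> {H, H #> y}"
          using coset_eq[of g] repr_independence[of g H y, OF _ y H] by auto
      qed
      show "{H, H #> y} \<subseteq> (\<lambda>g. H #> g) ` M"
        using yM coset_eq[OF subgroup.one_closed[OF H]] subgroup.one_closed[OF M] by blast
    qed
    finally show ?thesis .
  qed
  moreover have "H \<noteq> H #> y"
    using notin rcos_self[OF y H] by (auto simp: H_def)
  ultimately show "card (rcosets\<^bsub>G\<lparr>carrier := generate G (insert y S)\<rparr>\<^esub> (generate G S)) = 2"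
    by (simp add: H_def M_def)
qed

section \<open>The automorphism group of the truncated tree\<close>

lemma tree_aut_carrier:
  "f \<in> carrier (tree_aut n) \<longleftrightarrow> f \<in> Bij (tree_verts n) \<and> f [] = [] \<and>
     (\<forall>u \<in> tree_verts n. \<forall>v \<in> tree_verts n. tree_adj (f u) (f v) \<longleftrightarrow> tree_adj u v)"
  by (simp add: tree_aut_def)

lemma tree_aut_one: "\<one>\<^bsub>tree_aut n\<^esub> = (\<lambda>w \<in> tree_verts n. w)"
  by (simp add: tree_aut_def BijGroup_def)

lemma tree_aut_mult:
  "\<lbrakk>f \<in> carrier (tree_aut n); g \<in> carrier (tree_aut n)\<rbrakk>
     \<Longrightarrow> f \<otimes>\<^bsub>tree_aut n\<^esub> g = compose (tree_verts n) f g"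
  by (simp add: tree_aut_def BijGroup_def)

lemma Nil_in_tree_verts [simp]: "[] \<in> tree_verts n"
  by (simp add: tree_verts_def)

lemma Cons_in_tree_verts:
  "i # v \<in> tree_verts (Suc n) \<longleftrightarrow> i \<in> {0, 1, 2} \<and> v \<in> tree_verts n"
  by (auto simp: tree_verts_def)

lemma tree_aut_closed:
  "\<lbrakk>f \<in> carrier (tree_aut n); w \<in> tree_verts n\<rbrakk> \<Longrightarrow> f w \<in> tree_verts n"
  by (auto simp: tree_aut_carrier Bij_def bij_betw_def)

lemma tree_aut_inj:
  "\<lbrakk>f \<in> carrier (tree_aut n); v \<in> tree_verts n; w \<in> tree_verts n\<rbrakk> \<Longrightarrow> f v = f w \<longleftrightarrow> v = w"
  by (auto simp: tree_aut_carrier Bij_def bij_betw_def inj_on_def)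

lemma tree_aut_Nil_iff:
  "\<lbrakk>f \<in> carrier (tree_aut n); w \<in> tree_verts n\<rbrakk> \<Longrightarrow> f w = [] \<longleftrightarrow> w = []"
  using tree_aut_inj[of f n w "[]"] by (auto simp: tree_aut_carrier)

text \<open>It is a subgroup of \<open>BijGroup\<close>. Closure under inverses rests on adjacency
  being required as an equivalence: read at the preimages of two vertices, the condition for
  \<open>f\<close> becomes the one for its inverse.\<close>

lemma group_tree_aut: "group (tree_aut n)"
proof -
  let ?V = "tree_verts n"
  let ?C = "{f \<in> Bij ?V. f [] = [] \<and>
        (\<forall>u \<in> ?V. \<forall>v \<in> ?V. tree_adj (f u) (f v) \<longleftrightarrow> tree_adj u v)}"
  interpret B: group "BijGroup ?V" by (rule group_BijGroup)
  have "subgroup ?C (BijGroup ?V)"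
  proof (rule B.subgroupI)
    show "?C \<subseteq> carrier (BijGroup ?V)" by (auto simp: BijGroup_def)
    have "(\<lambda>w \<in> ?V. w) \<in> ?C" by (auto simp: id_Bij)
    then show "?C \<noteq> {}" by blast
  next
    fix f assume f: "f \<in> ?C"
    let ?g = "\<lambda>w \<in> ?V. inv_into ?V f w"
    have img: "f ` ?V = ?V" and inj: "inj_on f ?V"
      using f by (auto simp: Bij_def bij_betw_def)
    have gin: "?g w \<in> ?V" and fg: "f (?g w) = w" if "w \<in> ?V" for w
      using that img inv_into_into[of w f ?V] f_inv_into_f[of w f ?V] by auto
    have "?g [] = []"
      using f inj fg[of "[]"] gin[of "[]"] by (auto simp: inj_on_def)
    moreover have "tree_adj (?g u) (?g v) \<longleftrightarrow> tree_adj u v" if "u \<in> ?V" "v \<in> ?V" for u v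
      using f gin fg that by (smt (verit) mem_Collect_eq)
    moreover have "?g \<in> Bij ?V" using f by (intro restrict_inv_into_Bij) auto
    ultimately have "?g \<in> ?C" by blast
    then show "inv\<^bsub>BijGroup ?V\<^esub> f \<in> ?C" using f by (simp add: inv_BijGroup)
  next
    fix f g assume f: "f \<in> ?C" and g: "g \<in> ?C"
    have gin: "g w \<in> ?V" if "w \<in> ?V" for w
      using g that by (auto simp: Bij_def bij_betw_def)
    have "compose ?V f g \<in> ?C"
      using f g gin by (auto simp: compose_Bij compose_eq)
    then show "f \<otimes>\<^bsub>BijGroup ?V\<^esub> g \<in> ?C" using f g by (simp add: BijGroup_def)
  qed
  then show ?thesis unfolding tree_aut_def by (rule B.subgroup_imp_group)
qed

section \<open>Elements given by sections, and their products\<close>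

lemma tree_adj_Nil_Cons [simp]:
  "tree_adj [] (i # v) \<longleftrightarrow> v = []" "tree_adj (i # v) [] \<longleftrightarrow> v = []"
  by (auto simp: tree_adj_def)

lemma tree_adj_Cons_Cons [simp]: "tree_adj (i # u) (j # v) \<longleftrightarrow> i = j \<and> tree_adj u v"
  by (auto simp: tree_adj_def)

lemma not_tree_adj_Nil_Nil [simp]: "\<not> tree_adj [] []"
  by (auto simp: tree_adj_def)

lemma nth_triple_carrier:
  assumes "a \<in> C" "b \<in> C" "c \<in> C" "i \<in> {0, 1, 2 :: nat}"
  shows "[a, b, c] ! i \<in> C"
  using assms by auto

lemma from_sections_Nil [simp]: "from_sections n a b c \<pi> [] = []"
  by (simp add: from_sections_def)

lemma from_sections_Cons:
  "\<lbrakk>i \<in> {0, 1, 2}; v \<in> tree_verts n\<rbrakk>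
     \<Longrightarrow> from_sections (Suc n) a b c \<pi> (i # v) = \<pi> i # ([a, b, c] ! i) v"
  by (simp add: from_sections_def Cons_in_tree_verts)

text \<open>Adjacency is checked by cases. The root and a child stay adjacent because sections fix
  the root of their subtree; within one subtree the section preserves adjacency; different subtrees
  stay apart because \<open>\<pi>\<close> is injective.\<close>

lemma from_sections_carrier:
  assumes s: "a \<in> carrier (tree_aut n)" "b \<in> carrier (tree_aut n)" "c \<in> carrier (tree_aut n)"
    and \<pi>: "bij_betw \<pi> {0, 1, 2} {0, 1, 2}"
  shows "from_sections (Suc n) a b c \<pi> \<in> carrier (tree_aut (Suc n))"
proof -
  let ?f = "from_sections (Suc n) a b c \<pi>"
  let ?V = "tree_verts (Suc n)"
  note sec = nth_triple_carrier[OF s]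
  have \<pi>_in: "\<pi> i \<in> {0, 1, 2}" if "i \<in> {0, 1, 2}" for i
    by (rule bspec[OF bij_betwE[OF \<pi>] that])
  have \<pi>_eq: "\<pi> i = \<pi> j \<longleftrightarrow> i = j" if "i \<in> {0, 1, 2}" "j \<in> {0, 1, 2}" for i j
    using bij_betw_imp_inj_on[OF \<pi>] that by (meson inj_on_eq_iff)
  have adj: "tree_adj (?f u) (?f v) \<longleftrightarrow> tree_adj u v" if "u \<in> ?V" "v \<in> ?V" for u v
  proof (cases u; cases v)
    fix i u' j v' assume uv: "u = i # u'" "v = j # v'"
    then have i: "i \<in> {0, 1, 2}" "u' \<in> tree_verts n" and j: "j \<in> {0, 1, 2}" "v' \<in> tree_verts n"
      using that by (auto simp: Cons_in_tree_verts)
    show ?thesis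
      using sec[OF i(1)] i(2) j(2)
      by (auto simp: uv from_sections_Cons[OF i] from_sections_Cons[OF j] \<pi>_eq[OF i(1) j(1)]
          tree_aut_carrier)
  next
    fix j v' assume uv: "u = []" "v = j # v'"
    then have j: "j \<in> {0, 1, 2}" "v' \<in> tree_verts n"
      using that by (auto simp: Cons_in_tree_verts)
    show ?thesis
      using tree_aut_Nil_iff[OF sec[OF j(1)] j(2)] by (simp add: uv from_sections_Cons[OF j])
  next
    fix i u' assume uv: "u = i # u'" "v = []"
    then have i: "i \<in> {0, 1, 2}" "u' \<in> tree_verts n"
      using that by (auto simp: Cons_in_tree_verts)
    show ?thesis
      using tree_aut_Nil_iff[OF sec[OF i(1)] i(2)] by (simp add: uv from_sections_Cons[OF i])
  qed simp
  have inj: "inj_on ?f ?V"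
  proof (rule inj_onI)
    fix u v assume uv: "u \<in> ?V" "v \<in> ?V" "?f u = ?f v"
    show "u = v"
    proof (cases u; cases v)
      fix i u' j v' assume eq: "u = i # u'" "v = j # v'"
      then have i: "i \<in> {0, 1, 2}" "u' \<in> tree_verts n"
        and j: "j \<in> {0, 1, 2}" "v' \<in> tree_verts n"
        using uv by (auto simp: Cons_in_tree_verts)
      have "i = j" using uv(3) \<pi>_eq[OF i(1) j(1)]
        by (simp add: eq from_sections_Cons[OF i] from_sections_Cons[OF j])
      moreover have "([a, b, c] ! i) u' = ([a, b, c] ! j) v'" using uv(3)
        by (simp add: eq from_sections_Cons[OF i] from_sections_Cons[OF j])
      ultimately show ?thesis using tree_aut_inj[OF sec[OF i(1)] i(2) j(2)] by (simp add: eq)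
    qed (use uv in \<open>auto simp: from_sections_Cons Cons_in_tree_verts\<close>)
  qed
  have img: "?f ` ?V = ?V"
  proof
    show "?f ` ?V \<subseteq> ?V"
    proof
      fix w assume "w \<in> ?f ` ?V"
      then obtain u where u: "u \<in> ?V" "w = ?f u" by blast
      show "w \<in> ?V"
      proof (cases u)
        case (Cons i u')
        then have i: "i \<in> {0, 1, 2}" "u' \<in> tree_verts n"
          using u by (auto simp: Cons_in_tree_verts)
        show ?thesis using \<pi>_in[OF i(1)] tree_aut_closed[OF sec[OF i(1)] i(2)]
          by (simp add: u Cons from_sections_Cons[OF i] Cons_in_tree_verts)
      qed (use u in simp)
    qed
    show "?V \<subseteq> ?f ` ?V"
    proof
      fix w assume w: "w \<in> ?V"
      show "w \<in> ?f ` ?V"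
      proof (cases w)
        case Nil
        then show ?thesis by (force intro: image_eqI[of _ _ "[]"])
      next
        case (Cons j v)
        then have j: "j \<in> {0, 1, 2}" "v \<in> tree_verts n"
          using w by (auto simp: Cons_in_tree_verts)
        have "j \<in> \<pi> ` {0, 1, 2}"
          using j(1) by (simp only: bij_betw_imp_surj_on[OF \<pi>])
        then obtain i where "j = \<pi> i" "i \<in> {0, 1, 2}" by (rule imageE)
        then have i: "i \<in> {0, 1, 2}" "\<pi> i = j" by simp_all
        have "([a, b, c] ! i) ` tree_verts n = tree_verts n"
          using sec[OF i(1)] by (auto simp: tree_aut_carrier Bij_def bij_betw_def)
        then obtain u where u: "u \<in> tree_verts n" "([a, b, c] ! i) u = v"
          using j(2) by (metis imageE)
        have "?f (i # u) = w" using i u Cons by (simp add: from_sections_Cons[OF i(1) u(1)])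
        moreover have "i # u \<in> ?V" using i(1) u(1) by (simp only: Cons_in_tree_verts simp_thms)
        ultimately show ?thesis by (rule image_eqI[OF sym])
      qed
    qed
  qed
  have "?f \<in> Bij ?V"
    using inj img by (simp add: Bij_def bij_betw_def from_sections_def)
  then show ?thesis using adj by (simp add: tree_aut_carrier)
qed

text \<open>Allows a composite of cycles to be simplified by evaluating it at the three
  letters.\<close>

lemma from_sections_cong:
  assumes "\<And>i. i \<in> {0, 1, 2} \<Longrightarrow> \<pi> i = \<rho> i"
  shows "from_sections (Suc n) a b c \<pi> = from_sections (Suc n) a b c \<rho>"
  using assms
  by (auto simp: from_sections_def Cons_in_tree_verts fun_eq_iff restrict_def split: list.split)

text \<open>The right factor acts first, sending the subtree at \<open>i\<close> to the one at
  \<open>\<rho> i\<close>, where the left factor then applies its section. Hence the left sections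
  are permuted by \<open>\<rho>\<close>, and all later relations between elements reduce to
  relations between sections.\<close>

lemma from_sections_mult:
  assumes a: "a \<in> carrier (tree_aut n)" "b \<in> carrier (tree_aut n)" "c \<in> carrier (tree_aut n)"
    and a': "a' \<in> carrier (tree_aut n)" "b' \<in> carrier (tree_aut n)" "c' \<in> carrier (tree_aut n)"
    and \<pi>: "bij_betw \<pi> {0, 1, 2} {0, 1, 2}" and \<rho>: "bij_betw \<rho> {0, 1, 2} {0, 1, 2}"
  shows "from_sections (Suc n) a b c \<pi> \<otimes>\<^bsub>tree_aut (Suc n)\<^esub> from_sections (Suc n) a' b' c' \<rho> =
    from_sections (Suc n) (([a, b, c] ! \<rho> 0) \<otimes>\<^bsub>tree_aut n\<^esub> a')
      (([a, b, c] ! \<rho> 1) \<otimes>\<^bsub>tree_aut n\<^esub> b') (([a, b, c] ! \<rho> 2) \<otimes>\<^bsub>tree_aut n\<^esub> c') (\<pi> \<circ> \<rho>)"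
    (is "?f \<otimes>\<^bsub>_\<^esub> ?g = ?h")
proof -
  let ?V = "tree_verts (Suc n)"
  have f: "?f \<in> carrier (tree_aut (Suc n))" by (rule from_sections_carrier[OF a \<pi>])
  have g: "?g \<in> carrier (tree_aut (Suc n))" by (rule from_sections_carrier[OF a' \<rho>])
  have \<rho>_in: "\<rho> i \<in> {0, 1, 2}" if "i \<in> {0, 1, 2}" for i
    by (rule bspec[OF bij_betwE[OF \<rho>] that])
  have "compose ?V ?f ?g = ?h"
  proof
    fix w
    show "compose ?V ?f ?g w = ?h w"
    proof (cases "w \<in> ?V")
      case False
      then show ?thesis by (simp add: compose_def from_sections_def)
    next
      case True
      show ?thesis
      proof (cases w)
        case Nil
        then show ?thesis by (simp add: compose_def)
      next
        case (Cons i v)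
        then have i: "i \<in> {0, 1, 2}" "v \<in> tree_verts n"
          using True by (auto simp: Cons_in_tree_verts)
        note m = tree_aut_mult[OF nth_triple_carrier[OF a \<rho>_in]]
        have "compose ?V ?f ?g w = ?f (\<rho> i # ([a', b', c'] ! i) v)"
          using True by (simp add: compose_eq Cons from_sections_Cons[OF i])
        also have "\<dots> = \<pi> (\<rho> i) # ([a, b, c] ! \<rho> i) (([a', b', c'] ! i) v)"
          using from_sections_Cons[OF \<rho>_in[OF i(1)]
              tree_aut_closed[OF nth_triple_carrier[OF a' i(1)] i(2)]] by simp
        also have "\<dots> = ?h w"
          using i a' by (auto simp: Cons from_sections_Cons m compose_eq)
        finally show ?thesis .
      qed
    qed
  qed
  then show ?thesis using f g by (simp add: tree_aut_mult)
qed

lemma from_sections_one: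
  "from_sections (Suc n) (tree_id n) (tree_id n) (tree_id n) id = tree_id (Suc n)"
proof
  fix w
  show "from_sections (Suc n) (tree_id n) (tree_id n) (tree_id n) id w = tree_id (Suc n) w"
    by (cases w) (auto simp: tree_aut_one from_sections_def Cons_in_tree_verts)
qed

section \<open>The elements x, y, z and the groups L\<close>

lemma cycle_values:
  "cycle_of_list [0, 1, 2] (0::nat) = 1" "cycle_of_list [0, 1, 2] (1::nat) = 2"
  "cycle_of_list [0, 1, 2] (2::nat) = 0"
  "cycle_of_list [0, 1] (0::nat) = 1" "cycle_of_list [0, 1] (1::nat) = 0"
  "cycle_of_list [0, 1] (2::nat) = 2"
  by (simp_all add: transpose_def)

lemma bij_cycles:
  "bij_betw (cycle_of_list [0, 1, 2]) {0, 1, 2 :: nat} {0, 1, 2}"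
  "bij_betw (cycle_of_list [0, 1]) {0, 1, 2 :: nat} {0, 1, 2}"
  unfolding bij_betw_def inj_on_def
  by (auto simp: cycle_values simp del: cycle_of_list.simps One_nat_def)

text \<open>The dummy value at \<open>0\<close> is the identity, which is also every section of a
  level-one element. So the recursion holds from level \<open>0\<close> on, here and in the two
  analogues for \<open>y_elt\<close> and \<open>z_elt\<close>, and level one is no special case
  later.\<close>

lemma x_elt_Suc:
  "x_elt (Suc n) =
     from_sections (Suc n) (tree_id n) (tree_id n) (x_elt n) (cycle_of_list [0, 1, 2])"
  by (cases n) (simp_all add: level_one_def)

lemma y_elt_Suc:
  "y_elt (Suc n) = from_sections (Suc n) (tree_id n) (y_elt n) (x_elt n) (cycle_of_list [0, 1])"
  by (cases n) (simp_all add: level_one_def)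

lemma z_elt_Suc: "z_elt (Suc n) = from_sections (Suc n) (y_elt n) (y_elt n) (x_elt n) id"
  using from_sections_one[of 0] by (cases n) simp_all

lemma tree_id_carrier [simp]: "tree_id n \<in> carrier (tree_aut n)"
  by (simp add: group.is_monoid group_tree_aut monoid.one_closed)

lemma x_elt_carrier [simp]: "x_elt n \<in> carrier (tree_aut n)"
proof (induction n)
  case (Suc n)
  then show ?case unfolding x_elt_Suc by (intro from_sections_carrier bij_cycles) simp_all
qed simp

lemma y_elt_carrier [simp]: "y_elt n \<in> carrier (tree_aut n)"
proof (induction n)
  case (Suc n)
  then show ?case unfolding y_elt_Suc by (intro from_sections_carrier bij_cycles) simp_all
qed simp

lemma z_elt_carrier [simp]: "z_elt n \<in> carrier (tree_aut n)"
proof (cases n)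
  case (Suc m)
  show ?thesis unfolding Suc z_elt_Suc by (intro from_sections_carrier) simp_all
qed simp

declare L_grp.simps(2) [simp del]

lemma tree_embed_carrier:
  "g \<in> carrier (tree_aut n) \<Longrightarrow> tree_embed (Suc n) g \<in> carrier (tree_aut (Suc n))"
  by (auto simp: tree_embed_def intro!: from_sections_carrier)

lemma L_grp_subgroup: "subgroup (L_grp n) (tree_aut n)"
proof (induction n)
  case 0
  show ?case using group.triv_subgroup[OF group_tree_aut[of 0]] by simp
next
  case (Suc n)
  have "tree_embed (Suc n) ` L_grp n \<subseteq> carrier (tree_aut (Suc n))"
    using subgroup.mem_carrier[OF Suc.IH] tree_embed_carrier by blast
  then show ?case
    unfolding L_grp.simps by (intro group.generate_is_subgroup[OF group_tree_aut]) auto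
qed

lemma L_grp_carrier: "g \<in> L_grp n \<Longrightarrow> g \<in> carrier (tree_aut n)"
  by (rule subgroup.mem_carrier[OF L_grp_subgroup])

lemma x_elt_in_L_grp: "x_elt n \<in> L_grp n"
  by (cases n) (auto simp: L_grp.simps intro: generate.incl)

lemma z_elt_in_L_grp: "z_elt (Suc n) \<in> L_grp (Suc n)"
  by (auto simp: L_grp.simps intro: generate.incl)

section \<open>Conjugating the generators of L by y, one level up\<close>

context
  fixes n :: nat
  assumes y_sq: "y_elt n \<otimes>\<^bsub>tree_aut n\<^esub> y_elt n \<in> L_grp n"
begin

interpretation G: group "tree_aut n" by (rule group_tree_aut)
interpretation K: group "tree_aut (Suc n)" by (rule group_tree_aut)

private abbreviation "I \<equiv> tree_id n"
private abbreviation "x \<equiv> x_elt n"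
private abbreviation "y \<equiv> y_elt n"
private abbreviation "X \<equiv> x_elt (Suc n)"
private abbreviation "Y \<equiv> y_elt (Suc n)"
private abbreviation "Z \<equiv> z_elt (Suc n)"
private abbreviation "L \<equiv> L_grp (Suc n)"
private abbreviation "F \<equiv> from_sections (Suc n)"
private abbreviation mult (infixl \<open>\<odot>\<close> 70) where "f \<odot> g \<equiv> f \<otimes>\<^bsub>tree_aut (Suc n)\<^esub> g"
private abbreviation mult' (infixl \<open>\<cdot>\<close> 70) where "f \<cdot> g \<equiv> f \<otimes>\<^bsub>tree_aut n\<^esub> g"

private lemmas mult_rules = from_sections_mult bij_cycles cycle_values L_grp_carrier

private lemma L_mult: "f \<in> L \<Longrightarrow> g \<in> L \<Longrightarrow> f \<odot> g \<in> L"
  by (rule subgroup.m_closed[OF L_grp_subgroup])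

private lemma L_inv: "f \<in> L \<Longrightarrow> inv\<^bsub>tree_aut (Suc n)\<^esub> f \<in> L"
  by (rule subgroup.m_inv_closed[OF L_grp_subgroup])

text \<open>The relation says that \<open>h\<close> is the conjugate of \<open>g\<close> by
  \<open>X\<close>. It is put without inverses so that it can be verified by multiplying
  sections.\<close>

private lemma in_L_of_intertwine:
  assumes "X \<odot> g = h \<odot> X" "g \<in> L" "h \<in> carrier (tree_aut (Suc n))"
  shows "h \<in> L"
proof -
  have "h = X \<odot> g \<odot> inv\<^bsub>tree_aut (Suc n)\<^esub> X"
    unfolding assms(1) using assms(3) by (simp add: K.m_assoc)
  then show ?thesis using L_mult L_inv assms(2) x_elt_in_L_grp by metis
qed

private lemma first_in_L: "a \<in> L_grp n \<Longrightarrow> F a I I id \<in> L"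
  by (auto simp: L_grp.simps tree_embed_def intro!: generate.incl)

text \<open>The rotation \<open>X\<close> has trivial sections at \<open>0\<close> and
  \<open>1\<close>, so conjugating by it carries \<open>a\<close> unchanged from vertex
  \<open>0\<close> to \<open>1\<close>, and in the next lemma from \<open>1\<close> to
  \<open>2\<close>.\<close>

private lemma second_in_L:
  assumes a: "a \<in> L_grp n" shows "F I a I id \<in> L"
proof (rule in_L_of_intertwine)
  show "X \<odot> F a I I id = F I a I id \<odot> X"
    unfolding x_elt_Suc using L_grp_carrier[OF a]
    by (simp add: mult_rules del: cycle_of_list.simps One_nat_def)
qed (use a first_in_L L_grp_carrier in \<open>auto intro!: from_sections_carrier\<close>)

private lemma third_in_L:
  assumes a: "a \<in> L_grp n" shows "F I I a id \<in> L"
proof (rule in_L_of_intertwine)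
  show "X \<odot> F I a I id = F I I a id \<odot> X"
    unfolding x_elt_Suc using L_grp_carrier[OF a]
    by (simp add: mult_rules del: cycle_of_list.simps One_nat_def)
qed (use a second_in_L L_grp_carrier in \<open>auto intro!: from_sections_carrier\<close>)

text \<open>The section of \<open>Z\<close> at vertex \<open>2\<close> is \<open>x\<close>, an
  element of \<open>L_grp n\<close>, and can be cancelled by \<open>third_in_L\<close>.\<close>

private lemma yy_in_L: "F y y I id \<in> L"
proof -
  have ix: "inv\<^bsub>tree_aut n\<^esub> x \<in> L_grp n"
    by (rule subgroup.m_inv_closed[OF L_grp_subgroup x_elt_in_L_grp])
  have "Z \<odot> F I I (inv\<^bsub>tree_aut n\<^esub> x) id = F y y I id"
    unfolding z_elt_Suc by (simp add: from_sections_mult)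
  then show ?thesis using L_mult[OF z_elt_in_L_grp third_in_L[OF ix]] by simp
qed

text \<open>Swapping \<open>0\<close> and \<open>1\<close> combines the sections \<open>I\<close>
  and \<open>y\<close> of \<open>Y\<close> in both orders, so the square has \<open>y\<close> at
  both vertices and \<open>x \<cdot> x\<close> at \<open>2\<close>.\<close>

lemma y_elt_sq_in_L_grp_step: "Y \<odot> Y \<in> L"
proof -
  have xx: "x \<cdot> x \<in> L_grp n"
    by (rule subgroup.m_closed[OF L_grp_subgroup x_elt_in_L_grp x_elt_in_L_grp])
  have "Y \<odot> Y = F y y (x \<cdot> x) (cycle_of_list [0, 1] \<circ> cycle_of_list [0, 1])"
    unfolding y_elt_Suc by (simp add: mult_rules del: cycle_of_list.simps One_nat_def)
  also have "\<dots> = F y y (x \<cdot> x) id"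
    by (rule from_sections_cong) (auto simp: cycle_values simp del: cycle_of_list.simps One_nat_def)
  also have "\<dots> = F y y I id \<odot> F I I (x \<cdot> x) id"
    by (simp add: from_sections_mult)
  finally show ?thesis using L_mult[OF yy_in_L third_in_L[OF xx]] by simp
qed

text \<open>The sections of \<open>Z\<close> at \<open>0\<close> and \<open>1\<close> agree, so the
  swap does not disturb them, and each section of \<open>Y\<close> is a power of the section of
  \<open>Z\<close> at the same vertex.\<close>

private lemma Y_conj_Z: "Y \<odot> Z = Z \<odot> Y"
  unfolding y_elt_Suc z_elt_Suc
  by (simp add: mult_rules del: cycle_of_list.simps One_nat_def)

text \<open>The section of \<open>Y\<close> at \<open>0\<close> is trivial, so the swap carries
  \<open>a\<close> unchanged to vertex \<open>1\<close>.\<close>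

private lemma Y_conj_embed:
  assumes a: "a \<in> L_grp n" shows "Y \<odot> tree_embed (Suc n) a = F I a I id \<odot> Y"
  unfolding y_elt_Suc tree_embed_def using L_grp_carrier[OF a]
  by (simp add: mult_rules del: cycle_of_list.simps One_nat_def)

text \<open>A rotation c and a transposition t in the symmetric group on three letters satisfy c t c
  = t. So \<open>X \<odot> Y \<odot> X\<close> and \<open>Y\<close> act alike on the first level,
  and \<open>w\<close> is given by sections alone.\<close>

private lemma Y_conj_X: "\<exists>w \<in> L. X \<odot> Y \<odot> X = w \<odot> Y"
proof
  let ?iy = "inv\<^bsub>tree_aut n\<^esub> y"
  \<comment> \<open>Chosen so that \<open>?u \<cdot> y\<close> is
    \<open>x \<cdot> x \<cdot> ?iy\<close>, the section required at vertex \<open>0\<close>. The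
    assumption \<open>y_sq\<close> puts \<open>?u\<close> into \<open>L_grp n\<close>, and the
    remaining pair of sections \<open>y\<close> comes from \<open>yy_in_L\<close>.\<close>
  let ?u = "x \<cdot> x \<cdot> inv\<^bsub>tree_aut n\<^esub> (y \<cdot> y)"
  let ?w = "F ?u I I id \<odot> F y y I id"
  have "?u \<in> L_grp n"
    using y_sq x_elt_in_L_grp L_grp_subgroup[of n]
    by (simp add: subgroup.m_closed subgroup.m_inv_closed)
  then show "?w \<in> L" using first_in_L yy_in_L L_mult by blast
  have "?u \<cdot> y = x \<cdot> x \<cdot> ?iy"
    by (simp add: G.inv_mult_group G.m_assoc)
  then have w: "?w = F (x \<cdot> x \<cdot> ?iy) y I id"
    by (simp add: from_sections_mult)
  let ?c = "cycle_of_list [0, 1, 2 :: nat]" and ?t = "cycle_of_list [0, 1 :: nat]"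
  have YX: "Y \<odot> X = F y x x (?t \<circ> ?c)"
    unfolding x_elt_Suc y_elt_Suc
    by (simp add: mult_rules del: cycle_of_list.simps One_nat_def)
  have tc: "bij_betw (?t \<circ> ?c) {0, 1, 2} {0, 1, 2}"
    by (rule bij_betw_trans[OF bij_cycles])
  have "X \<odot> (Y \<odot> X) = F y (x \<cdot> x) x (?c \<circ> (?t \<circ> ?c))"
    unfolding YX unfolding x_elt_Suc[of n]
    by (simp add: mult_rules tc del: cycle_of_list.simps One_nat_def)
  also have "\<dots> = F y (x \<cdot> x) x ?t"
    by (rule from_sections_cong) (auto simp: cycle_values simp del: cycle_of_list.simps One_nat_def)
  also have "\<dots> = ?w \<odot> Y"
    unfolding w unfolding y_elt_Suc[of n]
    by (simp add: mult_rules G.m_assoc del: cycle_of_list.simps One_nat_def)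
  finally show "X \<odot> Y \<odot> X = ?w \<odot> Y" by (simp add: K.m_assoc)
qed

private lemma conj_eq:
  assumes "Y \<odot> g = h \<odot> Y" "h \<in> carrier (tree_aut (Suc n))"
  shows "Y \<odot> g \<odot> inv\<^bsub>tree_aut (Suc n)\<^esub> Y = h"
  unfolding assms(1) using assms(2) by (simp add: K.m_assoc)

lemma y_elt_conj_generators:
  assumes "s \<in> {x_elt (Suc n), z_elt (Suc n)} \<union> tree_embed (Suc n) ` L_grp n"
  shows "y_elt (Suc n) \<otimes>\<^bsub>tree_aut (Suc n)\<^esub> s \<otimes>\<^bsub>tree_aut (Suc n)\<^esub>
    inv\<^bsub>tree_aut (Suc n)\<^esub> y_elt (Suc n) \<in> L_grp (Suc n)"
proof -
  consider "s = X" | "s = Z" | a where "a \<in> L_grp n" "s = tree_embed (Suc n) a"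
    using assms by blast
  then show ?thesis
  proof cases
    case 1
    obtain w where w: "w \<in> L" "X \<odot> Y \<odot> X = w \<odot> Y" using Y_conj_X by blast
    have wc: "w \<in> carrier (tree_aut (Suc n))" using w(1) by (rule L_grp_carrier)
    let ?h = "inv\<^bsub>tree_aut (Suc n)\<^esub> X \<odot> w"
    \<comment> \<open>Cancelling the left \<open>X\<close> in
      \<open>X \<odot> Y \<odot> X = w \<odot> Y\<close> shows that the conjugate of
      \<open>X\<close> by \<open>Y\<close> is \<open>?h\<close>, a product of two elements of
      \<open>L\<close>.\<close>
    have "Y \<odot> X = inv\<^bsub>tree_aut (Suc n)\<^esub> X \<odot> (X \<odot> Y \<odot> X)"
      by (simp add: K.m_assoc[symmetric])
    then have "Y \<odot> X = ?h \<odot> Y" using wc by (simp add: w(2) K.m_assoc)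
    then have "Y \<odot> X \<odot> inv\<^bsub>tree_aut (Suc n)\<^esub> Y = ?h" using wc by (intro conj_eq) simp_all
    then show ?thesis using L_mult[OF L_inv[OF x_elt_in_L_grp] w(1)] 1 by metis
  next
    case 2
    then show ?thesis
      using conj_eq[OF Y_conj_Z z_elt_carrier] z_elt_in_L_grp by metis
  next
    case 3
    then show ?thesis
      using conj_eq[OF Y_conj_embed[OF 3(1)] L_grp_carrier[OF second_in_L[OF 3(1)]]]
        second_in_L[OF 3(1)] by metis
  qed
qed

end

text \<open>Discharges the assumption of the preceding context at every level.\<close>

lemma y_elt_sq_in_L_grp: "y_elt n \<otimes>\<^bsub>tree_aut n\<^esub> y_elt n \<in> L_grp n"
proof (induction n)
  case 0
  show ?case using monoid.l_one[OF group.is_monoid[OF group_tree_aut[of 0]]] by simp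
next
  case (Suc n)
  then show ?case by (rule y_elt_sq_in_L_grp_step)
qed

section \<open>Action on the first level\<close>

lemma single_in_tree_verts: "i < 3 \<Longrightarrow> [i] \<in> tree_verts (Suc n)"
  by (auto simp: tree_verts_def)

lemma from_sections_single:
  assumes "i < 3" "a \<in> carrier (tree_aut n)" "b \<in> carrier (tree_aut n)" "c \<in> carrier (tree_aut n)"
  shows "from_sections (Suc n) a b c \<pi> [i] = [\<pi> i]"
proof -
  have i: "i \<in> {0, 1, 2}" using assms(1) by auto
  show ?thesis
    using nth_triple_carrier[OF assms(2-4) i] from_sections_Cons[OF i Nil_in_tree_verts]
    by (simp add: tree_aut_carrier)
qed

lemma all_less_3: "(\<forall>i<3. P i) \<longleftrightarrow> P 0 \<and> P 1 \<and> P (2::nat)"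
  by (auto simp: numeral_3_eq_3 less_Suc_eq numeral_2_eq_2)

text \<open>The generator \<open>x_elt\<close> rotates the first level by one, the others fix it,
  and rotations are closed under products and inverses. This invariant separates
  \<open>L_grp\<close> from \<open>y_elt\<close>.\<close>

lemma L_grp_rotates_level_one:
  assumes "g \<in> L_grp (Suc n)"
  shows "\<exists>k. \<forall>i<3. g [i] = [(i + k) mod 3]"
proof -
  interpret K: group "tree_aut (Suc n)" by (rule group_tree_aut)
  have gen: "h \<in> carrier (tree_aut (Suc n)) \<and> (\<exists>k. \<forall>i<3. h [i] = [(i + k) mod 3])"
    if h: "h \<in> {x_elt (Suc n), z_elt (Suc n)} \<union> tree_embed (Suc n) ` L_grp n" for h
  proof -
    consider "h = x_elt (Suc n)" | "h = z_elt (Suc n)"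
      | a where "a \<in> L_grp n" "h = tree_embed (Suc n) a" using h by blast
    then show ?thesis
    proof cases
      case 1
      have "\<forall>i<3. h [i] = [(i + 1) mod 3]"
        unfolding 1 x_elt_Suc all_less_3
        by (simp add: from_sections_single cycle_values del: cycle_of_list.simps One_nat_def)
      then show ?thesis using x_elt_carrier[of "Suc n"] unfolding 1 by blast
    next
      case 2
      have "\<forall>i<3. h [i] = [(i + 0) mod 3]"
        unfolding 2 z_elt_Suc by (simp add: from_sections_single)
      then show ?thesis using 2 by (metis z_elt_carrier)
    next
      case 3
      have "\<forall>i<3. h [i] = [(i + 0) mod 3]"
        unfolding 3 tree_embed_def using L_grp_carrier[OF 3(1)] by (simp add: from_sections_single)
      then show ?thesis using 3 tree_embed_carrier[OF L_grp_carrier[OF 3(1)]] by metis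
    qed
  qed
  from assms[unfolded L_grp.simps]
  \<comment> \<open>Membership in the carrier is carried along because \<open>tree_aut_mult\<close>
    describes products only there.\<close>
  have "g \<in> carrier (tree_aut (Suc n)) \<and> (\<exists>k. \<forall>i<3. g [i] = [(i + k) mod 3])"
  proof (induction rule: generate.induct)
    case one
    have "\<forall>i<3. tree_id (Suc n) [i] = [(i + 0) mod 3]"
      by (simp add: tree_aut_one single_in_tree_verts)
    then show ?case by (metis tree_id_carrier)
  next
    case (incl h)
    then show ?case by (rule gen)
  next
    case (inv h)
    let ?h = "inv\<^bsub>tree_aut (Suc n)\<^esub> h"
    obtain k where h: "h \<in> carrier (tree_aut (Suc n))" and k: "\<forall>i<3. h [i] = [(i + k) mod 3]"
      using gen[OF inv] by blast
    \<comment> \<open>Rotation by \<open>2 * k\<close> inverts rotation by \<open>k\<close>, since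
      \<open>3 * k\<close> vanishes modulo \<open>3\<close>; this form avoids subtraction on
      naturals.\<close>
    have "?h [i] = [(i + 2 * k) mod 3]" if "i < 3" for i
    proof -
      have "((i + 2 * k) mod 3 + k) mod 3 = i" using that by presburger
      then have "[i] = h [(i + 2 * k) mod 3]" using k by simp
      moreover have "?h (h [(i + 2 * k) mod 3]) = [(i + 2 * k) mod 3]"
      proof -
        have v: "[(i + 2 * k) mod 3] \<in> tree_verts (Suc n)" by (intro single_in_tree_verts) simp
        have "compose (tree_verts (Suc n)) ?h h = (\<lambda>w \<in> tree_verts (Suc n). w)"
          using h by (simp add: tree_aut_mult[symmetric] tree_aut_one[symmetric])
        then have "compose (tree_verts (Suc n)) ?h h [(i + 2 * k) mod 3]
            = (\<lambda>w \<in> tree_verts (Suc n). w) [(i + 2 * k) mod 3]" by (rule fun_cong)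
        then show ?thesis using v by (simp add: compose_eq)
      qed
      ultimately show ?thesis by simp
    qed
    then show ?case using h by blast
  next
    case (eng a b)
    then obtain k l where a: "a \<in> carrier (tree_aut (Suc n))" "\<forall>i<3. a [i] = [(i + k) mod 3]"
      and b: "b \<in> carrier (tree_aut (Suc n))" "\<forall>i<3. b [i] = [(i + l) mod 3]" by blast
    have "(a \<otimes>\<^bsub>tree_aut (Suc n)\<^esub> b) [i] = [(i + (l + k)) mod 3]" if "i < 3" for i
      using a b that
      by (simp add: tree_aut_mult compose_eq single_in_tree_verts mod_add_left_eq add.assoc)
    then show ?case using a b by blast
  qed
  then show ?thesis by blast
qed

lemma y_elt_notin_L_grp: "y_elt (Suc n) \<notin> L_grp (Suc n)"
proof
  assume "y_elt (Suc n) \<in> L_grp (Suc n)"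
  then obtain k where k: "\<forall>i<3. y_elt (Suc n) [i] = [(i + k) mod 3]"
    using L_grp_rotates_level_one by blast
  have "y_elt (Suc n) [0] = [1]" "y_elt (Suc n) [2] = [2]"
    unfolding y_elt_Suc
    by (simp_all add: from_sections_single cycle_values del: cycle_of_list.simps One_nat_def)
  \<comment> \<open>The image of \<open>0\<close> forces \<open>k\<close> to be 1 modulo 3, while
    the fixed letter \<open>2\<close> forces it to be 0.\<close>
  then have "(0 + k) mod 3 = 1" "(2 + k) mod 3 = 2"
    using k by (metis list.inject zero_less_numeral, metis list.inject lessI numeral_3_eq_3 numeral_2_eq_2)
  then show False by presburger
qed

theorem theorem3p7:
  fixes n :: nat
  assumes "n \<ge> 1"
  shows "L_grp n \<lhd> (tree_aut n)\<lparr>carrier := M_grp n\<rparr> \<and>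
         card (rcosets\<^bsub>(tree_aut n)\<lparr>carrier := M_grp n\<rparr>\<^esub> (L_grp n)) = 2"
proof -
  obtain m where n: "n = Suc m" using assms by (cases n) auto
  let ?S = "{x_elt (Suc m), z_elt (Suc m)} \<union> tree_embed (Suc m) ` L_grp m"
  \<comment> \<open>Regrouped so that \<open>y_elt n\<close> is the one generator added to those of
    \<open>L_grp n\<close>, as the index-two criterion expects.\<close>
  have M: "M_grp n = generate (tree_aut n) (insert (y_elt n) ?S)"
    unfolding M_grp_def n by (rule arg_cong[of _ _ "generate _"]) auto
  have L: "L_grp n = generate (tree_aut n) ?S" by (simp add: n L_grp.simps)
  have "?S \<subseteq> carrier (tree_aut n)"
    using tree_embed_carrier L_grp_carrier by (auto simp: n)
  moreover have "y_elt n \<otimes>\<^bsub>tree_aut n\<^esub> s \<otimes>\<^bsub>tree_aut n\<^esub> inv\<^bsub>tree_aut n\<^esub> y_elt n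
      \<in> generate (tree_aut n) ?S" if "s \<in> ?S" for s
    using y_elt_conj_generators[OF y_elt_sq_in_L_grp that] by (simp add: n L_grp.simps)
  moreover have "y_elt n \<otimes>\<^bsub>tree_aut n\<^esub> y_elt n \<in> generate (tree_aut n) ?S"
    using y_elt_sq_in_L_grp[of n] unfolding L .
  moreover have "y_elt n \<notin> generate (tree_aut n) ?S"
    using y_elt_notin_L_grp[of m] by (simp add: n L_grp.simps)
  ultimately show ?thesis
    unfolding L M
    using group.generate_insert_index_two[OF group_tree_aut _ y_elt_carrier] by blast
qed

end
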